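(* Let $P$ be an infinite field, $X$ a finite set, and $F(X)$ the free Lie algebra over $P$ on $X$. Then any quasi-stable automorphism $\xi$ of the semigroup $\mathrm{End}(F(X))$ is linearly stable. Thus, $\xi$ is inner, i.e. there is $f\in\mathrm{Aut}(F(X))$ with $\xi(\varphi)=f\varphi f^{-1}$ for all $\varphi\in\mathrm{End}(F(X))$.
   Context: $\mathrm{End}(F(X))$ is the semigroup of Lie $P$-algebra endomorphisms of $F(X)$ and $\mathrm{Aut}(F(X))$ is its group of invertible elements. $\mathrm{Aut}_l(F(X))$ is the group of linear automorphisms of $F(X)$, i.e. those automorphisms sending every $x\in X$ to a $P$-linear combination of elements of $X$ (it is isomorphic to $\mathrm{GL}_n(P)$, $n=|X|$). $P^*=P\setminus\{0\}$. An automorphism of the group $\mathrm{Aut}_l(F(X))$ is called diagonal if it has the form $\tilde h$ for some group homomorphism $h:\mathrm{Aut}_l(F(X))\to P^*$, where $\tilde h(g)(x)=h(g)\,g(x)$ for all $g\in\mathrm{Aut}_l(F(X))$, $x\in X$. An automorphism $\xi$ of the semigroup $\mathrm{End}(F(X))$ is called quasi-stable if $\mathrm{Aut}_l(F(X))$ is invariant with respect to $\xi$ and the restriction of $\xi$ to $\mathrm{Aut}_l(F(X))$ is a diagonal automorphism. It is called linearly stable if $\xi(g)=g$ for every $g\in\mathrm{Aut}_l(F(X))$.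
   Formalization: The formal theorem assumes that X has at least two elements; for |X|=1 the claim is false (End(F(X)) is (P,·), and a ↦ a⁻¹, 0 ↦ 0 is quasi-stable but neither linearly stable nor inner), and the trivial case of empty X is also left out. *)

theory Defs
  imports Complex_Main "HOL-Library.Cardinality" "HOL-Algebra.Group"
begin

section \<open>Lie algebras\<close>

text \<open>Bracket additivity in the second argument is an axiom of its own, since
  antisymmetry is only a consequence of the alternating law.\<close>

locale lie_algebra = vector_space scale
  for scale :: "'p::field \<Rightarrow> 'v::ab_group_add \<Rightarrow> 'v" +
  fixes bracket :: "'v \<Rightarrow> 'v \<Rightarrow> 'v"
  assumes bracket_add_left: "bracket (u + v) w = bracket u w + bracket v w"
    and bracket_add_right: "bracket u (v + w) = bracket u v + bracket u w"
    and bracket_scale_left: "bracket (scale a u) v = scale a (bracket u v)"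
    and bracket_scale_right: "bracket u (scale a v) = scale a (bracket u v)"
    and bracket_self: "bracket u u = 0"
    and jacobi: "bracket u (bracket v w) + bracket v (bracket w u) + bracket w (bracket u v) = 0"

definition lie_hom ::
  "('p::field \<Rightarrow> 'v::ab_group_add \<Rightarrow> 'v) \<Rightarrow> ('v \<Rightarrow> 'v \<Rightarrow> 'v) \<Rightarrow>
   ('p \<Rightarrow> 'w::ab_group_add \<Rightarrow> 'w) \<Rightarrow> ('w \<Rightarrow> 'w \<Rightarrow> 'w) \<Rightarrow> ('v \<Rightarrow> 'w) \<Rightarrow> bool"
  where "lie_hom scale1 bracket1 scale2 bracket2 f \<longleftrightarrow>
    Vector_Spaces.linear scale1 scale2 f \<and>
    (\<forall>u v. f (bracket1 u v) = bracket2 (f u) (f v))"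


section \<open>The free Lie algebra over a field on the elements of a type\<close>

text \<open>Lie terms over the generators, modulo the least congruence that contains the
  axioms of Lie algebras.\<close>

datatype ('p, 'x) lie_term =
    TGen 'x
  | TZero
  | TAdd "('p, 'x) lie_term" "('p, 'x) lie_term"
  | TScale 'p "('p, 'x) lie_term"
  | TBracket "('p, 'x) lie_term" "('p, 'x) lie_term"

inductive lie_eq :: "('p::field, 'x) lie_term \<Rightarrow> ('p, 'x) lie_term \<Rightarrow> bool" where
  refl: "lie_eq s s"
| sym: "lie_eq s t \<Longrightarrow> lie_eq t s"
| trans: "lie_eq s t \<Longrightarrow> lie_eq t u \<Longrightarrow> lie_eq s u"
| cong_add: "lie_eq s s' \<Longrightarrow> lie_eq t t' \<Longrightarrow> lie_eq (TAdd s t) (TAdd s' t')"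
| cong_scale: "lie_eq s s' \<Longrightarrow> lie_eq (TScale a s) (TScale a s')"
| cong_bracket: "lie_eq s s' \<Longrightarrow> lie_eq t t' \<Longrightarrow> lie_eq (TBracket s t) (TBracket s' t')"
| add_assoc: "lie_eq (TAdd (TAdd s t) u) (TAdd s (TAdd t u))"
| add_commute: "lie_eq (TAdd s t) (TAdd t s)"
| add_zero: "lie_eq (TAdd TZero s) s"
| add_neg: "lie_eq (TAdd (TScale (- 1) s) s) TZero"
| scale_add: "lie_eq (TScale a (TAdd s t)) (TAdd (TScale a s) (TScale a t))"
| add_scale: "lie_eq (TScale (a + b) s) (TAdd (TScale a s) (TScale b s))"
| scale_scale: "lie_eq (TScale a (TScale b s)) (TScale (a * b) s)"
| scale_one: "lie_eq (TScale 1 s) s"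
| bracket_add_left: "lie_eq (TBracket (TAdd s t) u) (TAdd (TBracket s u) (TBracket t u))"
| bracket_add_right: "lie_eq (TBracket s (TAdd t u)) (TAdd (TBracket s t) (TBracket s u))"
| bracket_scale_left: "lie_eq (TBracket (TScale a s) t) (TScale a (TBracket s t))"
| bracket_scale_right: "lie_eq (TBracket s (TScale a t)) (TScale a (TBracket s t))"
| bracket_self: "lie_eq (TBracket s s) TZero"
| jacobi: "lie_eq (TAdd (TAdd (TBracket s (TBracket t u)) (TBracket t (TBracket u s)))
                        (TBracket u (TBracket s t))) TZero"

quotient_type (overloaded) ('p, 'x) free_lie = "('p::field, 'x) lie_term" / lie_eq
  by (intro equivpI reflpI sympI transpI) (auto intro: lie_eq.refl lie_eq.sym lie_eq.trans)

instantiation free_lie :: (field, type) ab_group_add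
begin

lift_definition zero_free_lie :: "('a, 'b) free_lie" is TZero .

lift_definition plus_free_lie :: "('a, 'b) free_lie \<Rightarrow> ('a, 'b) free_lie \<Rightarrow> ('a, 'b) free_lie"
  is TAdd by (rule cong_add)

lift_definition uminus_free_lie :: "('a, 'b) free_lie \<Rightarrow> ('a, 'b) free_lie"
  is "TScale (- 1)" by (rule cong_scale)

lift_definition minus_free_lie :: "('a, 'b) free_lie \<Rightarrow> ('a, 'b) free_lie \<Rightarrow> ('a, 'b) free_lie"
  is "\<lambda>s t. TAdd s (TScale (- 1) t)" by (intro cong_add cong_scale)

instance
proof
  fix a b c :: "('a, 'b) free_lie"
  show "a + b + c = a + (b + c)" by transfer (rule lie_eq.add_assoc)
  show "a + b = b + a" by transfer (rule lie_eq.add_commute)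
  show "0 + a = a" by transfer (rule lie_eq.add_zero)
  show "- a + a = 0" by transfer (rule lie_eq.add_neg)
  show "a - b = a + - b" by transfer (rule lie_eq.refl)
qed

end

lift_definition gen :: "'x \<Rightarrow> ('p::field, 'x) free_lie" is TGen .

lift_definition fl_scale :: "'p::field \<Rightarrow> ('p, 'x) free_lie \<Rightarrow> ('p, 'x) free_lie"
  is TScale by (rule cong_scale)

lift_definition fl_bracket ::
  "('p::field, 'x) free_lie \<Rightarrow> ('p, 'x) free_lie \<Rightarrow> ('p, 'x) free_lie"
  is TBracket by (rule cong_bracket)

interpretation free_lie: lie_algebra fl_scale fl_bracket
proof
  fix a b :: "'a::field" and u v w :: "('a, 'b) free_lie"
  show "fl_scale a (u + v) = fl_scale a u + fl_scale a v"
    by transfer (rule lie_eq.scale_add)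
  show "fl_scale (a + b) u = fl_scale a u + fl_scale b u"
    by transfer (rule lie_eq.add_scale)
  show "fl_scale a (fl_scale b u) = fl_scale (a * b) u"
    by transfer (rule lie_eq.scale_scale)
  show "fl_scale 1 u = u"
    by transfer (rule lie_eq.scale_one)
  show "fl_bracket (u + v) w = fl_bracket u w + fl_bracket v w"
    by transfer (rule lie_eq.bracket_add_left)
  show "fl_bracket u (v + w) = fl_bracket u v + fl_bracket u w"
    by transfer (rule lie_eq.bracket_add_right)
  show "fl_bracket (fl_scale a u) v = fl_scale a (fl_bracket u v)"
    by transfer (rule lie_eq.bracket_scale_left)
  show "fl_bracket u (fl_scale a v) = fl_scale a (fl_bracket u v)"
    by transfer (rule lie_eq.bracket_scale_right)
  show "fl_bracket u u = 0"
    by transfer (rule lie_eq.bracket_self)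
  show "fl_bracket u (fl_bracket v w) + fl_bracket v (fl_bracket w u)
      + fl_bracket w (fl_bracket u v) = 0"
    by transfer (rule lie_eq.jacobi)
qed

lemma free_lie_induct [case_names gen zero add scale bracket, induct type: free_lie]:
  fixes u :: "('p::field, 'x) free_lie"
  assumes "\<And>x. Q (gen x)" and "Q 0"
    and "\<And>v w. Q v \<Longrightarrow> Q w \<Longrightarrow> Q (v + w)"
    and "\<And>a v. Q v \<Longrightarrow> Q (fl_scale a v)"
    and "\<And>v w. Q v \<Longrightarrow> Q w \<Longrightarrow> Q (fl_bracket v w)"
  shows "Q u"
proof -
  have "Q (abs_free_lie t)" for t
  proof (induction t)
    case (TGen x) then show ?case using assms(1)[of x] by (simp add: gen.abs_eq)
  next
    case TZero then show ?case using assms(2) by (simp add: zero_free_lie.abs_eq)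
  next
    case (TAdd s t)
    then show ?case using assms(3) by (metis plus_free_lie.abs_eq)
  next
    case (TScale a s)
    then show ?case using assms(4) by (metis fl_scale.abs_eq)
  next
    case (TBracket s t)
    then show ?case using assms(5) by (metis fl_bracket.abs_eq)
  qed
  then show ?thesis by (metis Quotient_free_lie Quotient_abs_rep)
qed

primrec term_eval ::
  "('p \<Rightarrow> 'w::ab_group_add \<Rightarrow> 'w) \<Rightarrow> ('w \<Rightarrow> 'w \<Rightarrow> 'w) \<Rightarrow> ('x \<Rightarrow> 'w) \<Rightarrow> ('p, 'x) lie_term \<Rightarrow> 'w"
  where
    "term_eval sc br f (TGen x) = f x"
  | "term_eval sc br f TZero = 0"
  | "term_eval sc br f (TAdd s t) = term_eval sc br f s + term_eval sc br f t"
  | "term_eval sc br f (TScale a s) = sc a (term_eval sc br f s)"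
  | "term_eval sc br f (TBracket s t) = br (term_eval sc br f s) (term_eval sc br f t)"

lemma (in lie_algebra) term_eval_lie_eq:
  "lie_eq s t \<Longrightarrow> term_eval scale bracket f s = term_eval scale bracket f t"
proof (induction rule: lie_eq.induct)
qed (simp_all add: algebra_simps bracket_add_left bracket_add_right bracket_scale_left
      bracket_scale_right bracket_self jacobi[simplified add.assoc])

theorem (in lie_algebra) free_lie_universal:
  fixes f :: "'x \<Rightarrow> 'v"
  shows "\<exists>!\<phi>. lie_hom fl_scale fl_bracket scale bracket \<phi> \<and> (\<forall>x. \<phi> (gen x) = f x)"
proof (rule ex_ex1I)
  define \<phi> where "\<phi> u = term_eval scale bracket f (rep_free_lie u)" for u
  have \<phi>_abs: "\<phi> (abs_free_lie t) = term_eval scale bracket f t" for t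
    unfolding \<phi>_def
    by (rule term_eval_lie_eq) (metis Quotient_free_lie Quotient_rep_abs lie_eq.refl)
  have ex_abs: "\<exists>t. u = abs_free_lie t" for u :: "('p, 'x) free_lie"
    by (metis Quotient_free_lie Quotient_abs_rep)
  have "\<phi> (u + v) = \<phi> u + \<phi> v" for u v
    using ex_abs[of u] ex_abs[of v] by (auto simp: plus_free_lie.abs_eq \<phi>_abs)
  moreover have "\<phi> (fl_scale a u) = scale a (\<phi> u)" for a u
    using ex_abs[of u] by (auto simp: fl_scale.abs_eq \<phi>_abs)
  moreover have "\<phi> (fl_bracket u v) = bracket (\<phi> u) (\<phi> v)" for u v
    using ex_abs[of u] ex_abs[of v] by (auto simp: fl_bracket.abs_eq \<phi>_abs)
  moreover have "\<phi> (gen x) = f x" for x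
    by (simp add: gen.abs_eq \<phi>_abs)
  moreover have "vector_space scale" by unfold_locales
  ultimately show "\<exists>\<phi>. lie_hom fl_scale fl_bracket scale bracket \<phi> \<and> (\<forall>x. \<phi> (gen x) = f x)"
    unfolding lie_hom_def Vector_Spaces.linear_iff using free_lie.vector_space_axioms by blast
next
  fix \<phi> \<psi> :: "('p, 'x) free_lie \<Rightarrow> 'v"
  assume "lie_hom fl_scale fl_bracket scale bracket \<phi> \<and> (\<forall>x. \<phi> (gen x) = f x)"
    and "lie_hom fl_scale fl_bracket scale bracket \<psi> \<and> (\<forall>x. \<psi> (gen x) = f x)"
  then have \<phi>: "lie_hom fl_scale fl_bracket scale bracket \<phi>" "\<And>x. \<phi> (gen x) = f x"
    and \<psi>: "lie_hom fl_scale fl_bracket scale bracket \<psi>" "\<And>x. \<psi> (gen x) = f x" by auto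
  interpret \<phi>: Vector_Spaces.linear fl_scale scale \<phi> using \<phi> by (simp add: lie_hom_def)
  interpret \<psi>: Vector_Spaces.linear fl_scale scale \<psi> using \<psi> by (simp add: lie_hom_def)
  show "\<phi> = \<psi>"
  proof
    fix u show "\<phi> u = \<psi> u"
    proof (induction u)
      case (bracket v w)
      then show ?case using \<phi>(1) \<psi>(1) by (simp add: lie_hom_def)
    qed (simp_all add: \<phi>(2) \<psi>(2) \<phi>.add \<psi>.add \<phi>.scale \<psi>.scale \<phi>.zero \<psi>.zero)
  qed
qed


section \<open>Endomorphisms and automorphisms of the free Lie algebra\<close>

definition End_F :: "(('p::field, 'x) free_lie \<Rightarrow> ('p, 'x) free_lie) monoid" where
  "End_F = \<lparr>carrier = {\<phi>. lie_hom fl_scale fl_bracket fl_scale fl_bracket \<phi>},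
            mult = (\<circ>), one = id\<rparr>"

lemma monoid_End_F: "monoid (End_F :: (('p::field, 'x) free_lie \<Rightarrow> ('p, 'x) free_lie) monoid)"
  by unfold_locales
    (auto simp: End_F_def lie_hom_def Vector_Spaces.linear_iff free_lie.vector_space_axioms)

abbreviation Aut_F :: "(('p::field, 'x) free_lie \<Rightarrow> ('p, 'x) free_lie) monoid" where
  "Aut_F \<equiv> units_of End_F"

definition linear_Aut_F :: "(('p::field, 'x) free_lie \<Rightarrow> ('p, 'x) free_lie) monoid" where
  "linear_Aut_F = Aut_F
     \<lparr>carrier := {g \<in> carrier Aut_F. \<forall>x. g (gen x) \<in> module.span fl_scale (range gen)}\<rparr>"

definition mult_group_of_field :: "'p::field monoid" where
  "mult_group_of_field = \<lparr>carrier = UNIV - {0}, mult = (*), one = 1\<rparr>"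


section \<open>Automorphisms of the endomorphism semigroup\<close>

text \<open>A homomorphism of monoids in the library respects the multiplication only, so
  \<open>iso G G\<close> is the set of semigroup automorphisms. Elements of \<open>iso G G\<close> are
  unconstrained outside the carrier, which is why all conditions below are relative to
  carriers. In the first definition the displayed equation determines
  \<open>\<alpha> g\<close>, an endomorphism being determined by its values on the generators.\<close>

definition diagonal_automorphism ::
  "((('p::field, 'x) free_lie \<Rightarrow> ('p, 'x) free_lie) \<Rightarrow>
    (('p, 'x) free_lie \<Rightarrow> ('p, 'x) free_lie)) \<Rightarrow> bool" where
  "diagonal_automorphism \<alpha> \<longleftrightarrow>
     \<alpha> \<in> iso linear_Aut_F linear_Aut_F \<and>
     (\<exists>h \<in> hom linear_Aut_F mult_group_of_field.
        \<forall>g \<in> carrier linear_Aut_F. \<forall>x. \<alpha> g (gen x) = fl_scale (h g) (g (gen x)))"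

definition quasi_stable ::
  "((('p::field, 'x) free_lie \<Rightarrow> ('p, 'x) free_lie) \<Rightarrow>
    (('p, 'x) free_lie \<Rightarrow> ('p, 'x) free_lie)) \<Rightarrow> bool" where
  "quasi_stable \<xi> \<longleftrightarrow>
     \<xi> \<in> iso End_F End_F \<and>
     \<xi> ` carrier linear_Aut_F \<subseteq> carrier linear_Aut_F \<and>
     diagonal_automorphism (restrict \<xi> (carrier linear_Aut_F))"

definition linearly_stable ::
  "((('p::field, 'x) free_lie \<Rightarrow> ('p, 'x) free_lie) \<Rightarrow>
    (('p, 'x) free_lie \<Rightarrow> ('p, 'x) free_lie)) \<Rightarrow> bool" where
  "linearly_stable \<xi> \<longleftrightarrow>
     \<xi> \<in> iso End_F End_F \<and> (\<forall>g \<in> carrier linear_Aut_F. \<xi> g = g)"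

definition inner_automorphism ::
  "((('p::field, 'x) free_lie \<Rightarrow> ('p, 'x) free_lie) \<Rightarrow>
    (('p, 'x) free_lie \<Rightarrow> ('p, 'x) free_lie)) \<Rightarrow> bool" where
  "inner_automorphism \<xi> \<longleftrightarrow>
     (\<exists>f \<in> carrier Aut_F. \<forall>\<phi> \<in> carrier End_F.
        \<xi> \<phi> = f \<otimes>\<^bsub>End_F\<^esub> \<phi> \<otimes>\<^bsub>End_F\<^esub> inv\<^bsub>End_F\<^esub> f)"

end

theory Submission
  imports Defs "HOL-Computational_Algebra.Polynomial"
begin

text \<open>The proof compares \<open>\<xi> \<phi>\<close> and \<open>\<phi>\<close> through their relations with linear endomorphisms,
  starting from \<open>\<xi> g = h g \<cdot> g\<close> on linear automorphisms. Over an infinite field the elements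
  homogeneous of degree \<open>d\<close> are exactly those on which every scaling \<open>x \<mapsto> c x\<close> of the generators acts
  as \<open>c\<^sup>d\<close> (\<open>homogeneousI_scaling\<close>).

  Linear stability. An endomorphism is linear if and only if it commutes with all scalings, and
  \<open>\<xi>\<close> permutes the scalings, so \<open>\<xi>\<close> maps linear endomorphisms to linear ones. Consider the
  projection \<open>e\<^sub>i = column i (gen i)\<close> onto the line of the generator \<open>x\<^sub>i\<close>. If \<open>g\<close> fixes \<open>x\<^sub>i\<close> then \<open>g e\<^sub>i = e\<^sub>i\<close>, hence
  \<open>h g \<cdot> g\<close> fixes the image of \<open>\<xi> e\<^sub>i\<close>. Letting \<open>g\<close> run through transvections shows that this image
  is the line of \<open>x\<^sub>i\<close>; therefore \<open>h g = 1\<close> for each \<open>g\<close> that fixes some generator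
  (\<open>h_eq_1_if_fixes_gen\<close>). Relations with dilations then give \<open>\<xi> e\<^sub>i = e\<^sub>i\<close>, and all matrix units
  are fixed as well. For arbitrary \<open>g\<close> with a nonzero matrix entry \<open>a\<close> at \<open>(i, j)\<close>, the product
  \<open>e\<^sub>i g e\<^sub>j\<close> is a fixed dilation times a matrix unit, which forces \<open>h g = 1\<close>
  (\<open>xi_fixes_linear\<close>).

  Innerness. The endomorphisms that kill all generators but one correspond to the elements of the
  algebra, and \<open>\<xi>\<close> permutes them; this yields a bijection \<open>s\<close> (named \<open>perm\<close>) of the algebra that fixes the
  generators and satisfies \<open>\<xi> \<phi> (s u) = s (\<phi> u)\<close>. It is linear, since \<open>u + v\<close> is the image of
  \<open>x\<^sub>i + x\<^sub>j\<close> under the endomorphism that sends \<open>x\<^sub>i\<close> to \<open>u\<close> and \<open>x\<^sub>j\<close> to \<open>v\<close>. In the same way, its effect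
  on brackets is determined by \<open>s [x\<^sub>i, x\<^sub>j]\<close>, which is homogeneous of degree 2 and involves no
  other generators, so it equals \<open>c [x\<^sub>i, x\<^sub>j]\<close> for some \<open>c\<close>. Thus
  \<open>s [u, v] = c [s u, s v]\<close> (\<open>perm_bracket\<close>), the map \<open>f = c s\<close> is an automorphism of the Lie
  algebra, and \<open>\<xi> \<phi> = f \<phi> f\<^sup>-\<^sup>1\<close>.\<close>

section \<open>Endomorphisms of the free Lie algebra\<close>

abbreviation lie_endo :: "(('p::field, 'x) free_lie \<Rightarrow> ('p, 'x) free_lie) \<Rightarrow> bool" where
  "lie_endo \<equiv> lie_hom fl_scale fl_bracket fl_scale fl_bracket"

lemma lie_endoI:
  assumes "\<And>u v. \<phi> (u + v) = \<phi> u + \<phi> v" "\<And>a u. \<phi> (fl_scale a u) = fl_scale a (\<phi> u)"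
    "\<And>u v. \<phi> (fl_bracket u v) = fl_bracket (\<phi> u) (\<phi> v)"
  shows "lie_endo \<phi>"
  unfolding lie_hom_def Vector_Spaces.linear_iff
  using assms free_lie.vector_space_axioms by blast

lemma lie_endoD:
  assumes "lie_endo \<phi>"
  shows lie_endo_add: "\<phi> (u + v) = \<phi> u + \<phi> v"
    and lie_endo_scale: "\<phi> (fl_scale a u) = fl_scale a (\<phi> u)"
    and lie_endo_bracket: "\<phi> (fl_bracket u v) = fl_bracket (\<phi> u) (\<phi> v)"
    and lie_endo_zero: "\<phi> 0 = 0"
    and lie_endo_minus: "\<phi> (- u) = - \<phi> u"
    and lie_endo_diff: "\<phi> (u - v) = \<phi> u - \<phi> v"
proof -
  interpret Vector_Spaces.linear fl_scale fl_scale \<phi> using assms by (simp add: lie_hom_def)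
  show "\<phi> (u + v) = \<phi> u + \<phi> v" by (rule add)
  show "\<phi> (fl_scale a u) = fl_scale a (\<phi> u)" by (rule scale)
  show "\<phi> (fl_bracket u v) = fl_bracket (\<phi> u) (\<phi> v)" using assms by (simp add: lie_hom_def)
  show "\<phi> 0 = 0" by (rule zero)
  show "\<phi> (- u) = - \<phi> u" by (rule neg)
  show "\<phi> (u - v) = \<phi> u - \<phi> v" by (rule diff)
qed

lemma lie_endo_sum:
  assumes "lie_endo \<phi>"
  shows "\<phi> (sum w A) = (\<Sum>n\<in>A. \<phi> (w n))"
  by (induction A rule: infinite_finite_induct)
    (simp_all add: lie_endo_add[OF assms] lie_endo_zero[OF assms])

lemma lie_endo_id: "lie_endo id"
  by (rule lie_endoI) simp_all

lemma lie_endo_comp: "lie_endo \<phi> \<Longrightarrow> lie_endo \<psi> \<Longrightarrow> lie_endo (\<phi> \<circ> \<psi>)"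
  by (rule lie_endoI) (simp_all add: lie_endoD)

lemma lie_endo_eqI:
  assumes "lie_endo \<phi>" "lie_endo \<psi>" "\<And>x. \<phi> (gen x) = \<psi> (gen x)"
  shows "\<phi> = \<psi>"
  using free_lie.free_lie_universal[of "\<lambda>x. \<phi> (gen x)"] assms by metis

text \<open>The endomorphism that extends a given map on the generators.\<close>

definition extend_gens :: "('x \<Rightarrow> ('p::field, 'x) free_lie) \<Rightarrow> ('p, 'x) free_lie \<Rightarrow> ('p, 'x) free_lie" where
  "extend_gens f = (THE \<phi>. lie_endo \<phi> \<and> (\<forall>x. \<phi> (gen x) = f x))"

lemma
  shows lie_endo_extend_gens: "lie_endo (extend_gens f)"
    and extend_gens_gen [simp]: "extend_gens f (gen x) = f x"
  using theI'[OF free_lie.free_lie_universal[of f]] unfolding extend_gens_def by auto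

lemmas extend_gens_simps [simp] = lie_endoD[OF lie_endo_extend_gens]

lemma extend_gens_eqI: "lie_endo \<phi> \<Longrightarrow> (\<And>x. \<phi> (gen x) = f x) \<Longrightarrow> \<phi> = extend_gens f"
  by (rule lie_endo_eqI) (simp_all add: lie_endo_extend_gens)

lemma carrier_End_F: "carrier End_F = {\<phi>. lie_endo \<phi>}"
  by (simp add: End_F_def)

lemma mult_End_F [simp]: "\<phi> \<otimes>\<^bsub>End_F\<^esub> \<psi> = \<phi> \<circ> \<psi>"
  by (simp add: End_F_def)

lemma one_End_F [simp]: "\<one>\<^bsub>End_F\<^esub> = id"
  by (simp add: End_F_def)

lemma carrier_Aut_F:
  "g \<in> carrier Aut_F \<longleftrightarrow> lie_endo g \<and> (\<exists>k. lie_endo k \<and> k \<circ> g = id \<and> g \<circ> k = id)"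
  by (auto simp: units_of_def Units_def carrier_End_F)

lemma carrier_linear_Aut_F:
  "g \<in> carrier linear_Aut_F \<longleftrightarrow>
     g \<in> carrier Aut_F \<and> (\<forall>x. g (gen x) \<in> free_lie.span (range gen))"
  by (auto simp: linear_Aut_F_def)


section \<open>Coordinates on the linear part\<close>

text \<open>The coefficient of a generator in the linear part of an element. It is the homomorphism
  into the one-dimensional abelian Lie algebra which sends this generator to 1 and the
  others to 0.\<close>

definition coord :: "'x \<Rightarrow> ('p::field, 'x) free_lie \<Rightarrow> 'p" where
  "coord x = (THE \<phi>. lie_hom fl_scale fl_bracket (*) (\<lambda>_ _. 0) \<phi> \<and>
                (\<forall>y. \<phi> (gen y) = (if y = x then 1 else 0)))"

lemma
  fixes x :: 'x and u v :: "('p::field, 'x) free_lie"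
  shows coord_add [simp]: "coord x (u + v) = coord x u + coord x v"
    and coord_scale [simp]: "coord x (fl_scale a u) = a * coord x u"
    and coord_zero [simp]: "coord x (0 :: ('p, 'x) free_lie) = 0"
    and coord_gen [simp]: "coord x (gen y :: ('p, 'x) free_lie) = (if y = x then 1 else 0)"
proof -
  interpret A: lie_algebra "(*) :: 'p \<Rightarrow> 'p \<Rightarrow> 'p" "\<lambda>_ _. 0"
    by unfold_locales (simp_all add: algebra_simps)
  have *: "lie_hom fl_scale fl_bracket (*) (\<lambda>_ _. 0) (coord x :: ('p, 'x) free_lie \<Rightarrow> 'p) \<and>
      (\<forall>y. coord x (gen y :: ('p, 'x) free_lie) = (if y = x then 1 else 0))"
    unfolding coord_def by (rule theI'[OF A.free_lie_universal])
  then interpret Vector_Spaces.linear fl_scale "(*)" "coord x :: ('p, 'x) free_lie \<Rightarrow> 'p"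
    by (simp add: lie_hom_def)
  show "coord x (u + v) = coord x u + coord x v" by (rule add)
  show "coord x (fl_scale a u) = a * coord x u" by (rule scale)
  show "coord x (0 :: ('p, 'x) free_lie) = 0" by (rule zero)
  show "coord x (gen y :: ('p, 'x) free_lie) = (if y = x then 1 else 0)" using * by simp
qed

lemma gen_nonzero [simp]: "gen x \<noteq> (0 :: ('p::field, 'x) free_lie)"
  by (metis coord_gen coord_zero zero_neq_one)

lemma span_gen_expand:
  fixes v :: "('p::field, 'x::finite) free_lie"
  assumes "v \<in> free_lie.span (range gen)"
  shows "v = (\<Sum>x\<in>UNIV. fl_scale (coord x v) (gen x))"
  using assms
proof (induction v rule: free_lie.span_induct_alt)
  case base
  then show ?case by simp
next
  case (step c v w)
  then obtain y where y: "v = gen y" by auto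
  have "(\<Sum>x\<in>UNIV. fl_scale (coord x v) (gen x :: ('p, 'x) free_lie))
      = (\<Sum>x\<in>UNIV. if y = x then gen x else 0)"
    by (rule sum.cong) (simp_all add: y)
  also have "\<dots> = v" by (simp add: y)
  finally have v: "(\<Sum>x\<in>UNIV. fl_scale (coord x v) (gen x)) = v" .
  have "(\<Sum>x\<in>UNIV. fl_scale (coord x (fl_scale c v + w)) (gen x))
      = fl_scale c (\<Sum>x\<in>UNIV. fl_scale (coord x v) (gen x))
        + (\<Sum>x\<in>UNIV. fl_scale (coord x w) (gen x))"
    by (simp add: free_lie.scale_left_distrib sum.distrib free_lie.scale_sum_right)
  then show ?case using v step.IH by simp
qed

text \<open>The endomorphism that multiplies all generators by the same scalar.\<close>

abbreviation scaling :: "'p::field \<Rightarrow> ('p, 'x) free_lie \<Rightarrow> ('p, 'x) free_lie" where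
  "scaling c \<equiv> extend_gens (\<lambda>x. fl_scale c (gen x))"

text \<open>A relation between endomorphisms that holds up to a scalar on the generators extends to
  linear elements only, since brackets multiply the scalars.\<close>

lemma lie_endo_scales_span:
  assumes "lie_endo \<phi>" "\<And>x. \<phi> (gen x) = fl_scale c (\<psi> (gen x))" "lie_endo \<psi>"
    and "v \<in> free_lie.span (range gen)"
  shows "\<phi> v = fl_scale c (\<psi> v)"
  using assms(4)
proof (induction v rule: free_lie.span_induct_alt)
  case base
  then show ?case by (simp add: lie_endo_zero assms)
next
  case (step a v w)
  then show ?case
    by (auto simp: lie_endoD[OF assms(1)] lie_endoD[OF assms(3)] assms(2)
        free_lie.scale_right_distrib mult.commute)
qed

lemma scaling_span:
  "v \<in> free_lie.span (range gen) \<Longrightarrow> scaling c v = fl_scale c v"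
  using lie_endo_scales_span[OF lie_endo_extend_gens _ lie_endo_id, of "\<lambda>x. fl_scale c (gen x)" c v]
  by simp


section \<open>Homogeneous elements\<close>

text \<open>Homogeneous elements of a given degree, defined by their generation rules: zero is
  homogeneous of every degree.\<close>

inductive homogeneous :: "nat \<Rightarrow> ('p::field, 'x) free_lie \<Rightarrow> bool" where
  gen: "homogeneous 1 (gen x)"
| zero: "homogeneous n 0"
| add: "homogeneous n u \<Longrightarrow> homogeneous n v \<Longrightarrow> homogeneous n (u + v)"
| scale: "homogeneous n u \<Longrightarrow> homogeneous n (fl_scale a u)"
| bracket: "homogeneous m u \<Longrightarrow> homogeneous n v \<Longrightarrow> homogeneous (m + n) (fl_bracket u v)"

lemma scaling_homogeneous: "homogeneous n u \<Longrightarrow> scaling c u = fl_scale (c ^ n) u"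
  by (induction rule: homogeneous.induct)
    (simp_all add: free_lie.scale_right_distrib mult.commute power_add
      free_lie.bracket_scale_left free_lie.bracket_scale_right)

lemma fl_bracket_zero [simp]:
  "fl_bracket 0 u = 0" "fl_bracket u 0 = 0"
  using free_lie.bracket_scale_left[of 0 u u] free_lie.bracket_scale_right[of u 0 u] by simp_all

lemma fl_bracket_span:
  assumes "u \<in> free_lie.span A" "v \<in> free_lie.span B"
    and "\<And>a b. a \<in> A \<Longrightarrow> b \<in> B \<Longrightarrow> fl_bracket a b \<in> free_lie.span C"
  shows "fl_bracket u v \<in> free_lie.span C"
  using assms(1)
proof (induction u rule: free_lie.span_induct_alt)
  case base
  then show ?case by (simp add: free_lie.span_zero)
next
  case (step c a w)
  from assms(2) have "fl_bracket a v \<in> free_lie.span C"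
  proof (induction v rule: free_lie.span_induct_alt)
    case base
    then show ?case by (simp add: free_lie.span_zero)
  next
    case (step c b w)
    then show ?case using assms(3) \<open>a \<in> A\<close>
      by (simp add: free_lie.bracket_add_right free_lie.bracket_scale_right
          free_lie.span_add free_lie.span_scale)
  qed
  then show ?case using step
    by (simp add: free_lie.bracket_add_left free_lie.bracket_scale_left
        free_lie.span_add free_lie.span_scale)
qed

lemma homogeneous_low_degree:
  assumes "homogeneous n u"
  shows "(n = 0 \<longrightarrow> u = 0) \<and> (n = 1 \<longrightarrow> u \<in> free_lie.span (range gen)) \<and>
    (n = 2 \<longrightarrow> u \<in> free_lie.span {fl_bracket (gen x) (gen y) | x y. True})"
  using assms
proof (induction rule: homogeneous.induct)
  case (bracket m u n v)
  have "fl_bracket u v \<in> free_lie.span {fl_bracket (gen x) (gen y) | x y. True}" if "m = 1" "n = 1"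
    by (rule fl_bracket_span[where A = "range gen" and B = "range gen"])
      (use bracket.IH that in \<open>auto intro: free_lie.span_base\<close>)
  moreover have "m + n = 2 \<Longrightarrow> m = 0 \<or> n = 0 \<or> (m = 1 \<and> n = 1)" by auto
  moreover have "m + n = 1 \<Longrightarrow> m = 0 \<or> n = 0" by auto
  ultimately show ?case using bracket.IH by (auto simp: free_lie.span_zero)
qed (simp_all add: free_lie.span_zero free_lie.span_base free_lie.span_add free_lie.span_scale)

lemma span_homogeneous: "u \<in> free_lie.span {v. \<exists>n. homogeneous n v}"
proof (induction u)
  case (bracket v w)
  then show ?case
    by (rule fl_bracket_span) (auto intro: free_lie.span_base homogeneous.bracket)
qed (auto intro: free_lie.span_base free_lie.span_zero free_lie.span_add free_lie.span_scale
    homogeneous.intros)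

lemma homogeneous_decomposition:
  "\<exists>w k. (\<forall>n. homogeneous n (w n)) \<and> (\<forall>n>k. w n = 0) \<and> u = (\<Sum>n\<le>k. w n)"
  using span_homogeneous[of u]
proof (induction u rule: free_lie.span_induct_alt)
  case base
  show ?case by (rule exI[of _ "\<lambda>_. 0"]) (simp add: homogeneous.zero)
next
  case (step c v u)
  then obtain w k where w: "\<forall>n. homogeneous n (w n)" "\<forall>n>k. w n = 0" "u = (\<Sum>n\<le>k. w n)"
    by blast
  obtain m where m: "homogeneous m v" using step by auto
  define w' where "w' n = (if n = m then fl_scale c v else 0) + w n" for n
  have "u = (\<Sum>n\<le>max k m. w n)"
    unfolding w(3) by (rule sum.mono_neutral_left) (use w(2) in auto)
  then have "fl_scale c v + u = (\<Sum>n\<le>max k m. w' n)"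
    by (simp add: w'_def sum.distrib)
  moreover have "\<forall>n. homogeneous n (w' n)" "\<forall>n>max k m. w' n = 0"
    using m w by (auto simp: w'_def intro: homogeneous.intros)
  ultimately show ?case by blast
qed

lemma exists_power_neq_one:
  assumes "infinite (UNIV :: 'p::field set)" "0 < m"
  shows "\<exists>c::'p. c \<noteq> 0 \<and> c ^ m \<noteq> 1"
proof -
  let ?p = "monom 1 m - 1 :: 'p poly"
  have "coeff ?p m = 1" using assms(2) by (simp add: coeff_1)
  then have "?p \<noteq> 0" by (metis coeff_0 zero_neq_one)
  then have "finite {c. poly ?p c = 0}" by (rule poly_roots_finite)
  then have "infinite (UNIV - ({c. poly ?p c = 0} \<union> {0}))"
    using assms(1) by (simp add: Diff_infinite_finite)
  then obtain c where "c \<in> UNIV - ({c. poly ?p c = 0} \<union> {0})"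
    by (metis ex_in_conv finite.emptyI)
  then show ?thesis by (auto simp: poly_monom)
qed

text \<open>Eigenvectors of the scalings for distinct weights are linearly independent.\<close>

lemma scaling_weights_independent:
  fixes w :: "nat \<Rightarrow> ('p::field, 'x) free_lie"
  assumes "infinite (UNIV :: 'p set)"
    and "\<And>n c. c \<noteq> 0 \<Longrightarrow> scaling c (w n) = fl_scale (c ^ n) (w n)"
    and "(\<Sum>n\<le>k. w n) = 0" and "n \<le> k"
  shows "w n = 0"
  using assms(2-)
proof (induction k arbitrary: w n)
  case 0
  then show ?case by simp
next
  case (Suc k)
  have low: "w m = 0" if m: "m \<le> k" for m
  proof -
    have "0 < Suc k - m" using m by simp
    then obtain c :: 'p where c: "c \<noteq> 0" "c ^ (Suc k - m) \<noteq> 1"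
      using exists_power_neq_one[OF assms(1)] by blast
    \<comment> \<open>Applying the scaling by \<open>c\<close> and subtracting \<open>c ^ Suc k\<close> times the relation removes the
      top weight.\<close>
    define w' where "w' n = fl_scale (c ^ n - c ^ Suc k) (w n)" for n
    have "(\<Sum>n\<le>Suc k. w' n) = scaling c (\<Sum>n\<le>Suc k. w n) - fl_scale (c ^ Suc k) (\<Sum>n\<le>Suc k. w n)"
      unfolding lie_endo_sum[OF lie_endo_extend_gens] free_lie.scale_sum_right w'_def
        free_lie.scale_left_diff_distrib sum_subtractf
      using Suc.prems(1)[OF c(1)] by simp
    then have "(\<Sum>n\<le>Suc k. w' n) = 0" unfolding Suc.prems(2) by simp
    moreover have "w' (Suc k) = 0" by (simp add: w'_def)
    ultimately have "(\<Sum>n\<le>k. w' n) = 0" by simp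
    moreover have "\<And>n b. b \<noteq> 0 \<Longrightarrow> scaling b (w' n) = fl_scale (b ^ n) (w' n)"
      by (simp add: w'_def Suc.prems(1) mult.commute)
    ultimately have "w' m = 0" using Suc.IH m by blast
    moreover have "c ^ Suc k = c ^ (Suc k - m) * c ^ m"
      using m by (simp flip: power_add)
    then have "c ^ m - c ^ Suc k \<noteq> 0" using c by simp
    ultimately show ?thesis by (simp add: w'_def)
  qed
  then have "w (Suc k) = 0" using Suc.prems(2) by simp
  with low show ?case using Suc.prems(3) le_Suc_eq by metis
qed

text \<open>A weight vector for the weight \<open>c\<^sup>d\<close> equals its own component of degree \<open>d\<close>, since all
  homogeneous components are weight vectors themselves.\<close>

lemma homogeneousI_scaling:
  fixes u :: "('p::field, 'x) free_lie"
  assumes "infinite (UNIV :: 'p set)"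
    and "\<And>c. c \<noteq> 0 \<Longrightarrow> scaling c u = fl_scale (c ^ d) u"
  shows "homogeneous d u"
proof -
  obtain w k where w: "\<forall>n. homogeneous n (w n)" "\<forall>n>k. w n = 0" "u = (\<Sum>n\<le>k. w n)"
    using homogeneous_decomposition by blast
  define w' where "w' n = w n + (if n = d then - u else 0)" for n
  have "u = (\<Sum>n\<le>max k d. w n)"
    unfolding w(3) by (rule sum.mono_neutral_left) (use w(2) in auto)
  then have "(\<Sum>n\<le>max k d. w' n) = 0"
    by (simp add: w'_def sum.distrib)
  moreover have "scaling c (w' n) = fl_scale (c ^ n) (w' n)" if "c \<noteq> 0" for c n
    using assms(2)[OF that] scaling_homogeneous[of n "w n" c] w(1)
    by (simp add: w'_def free_lie.scale_right_distrib)
  ultimately have "w' d = 0"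
    by (intro scaling_weights_independent[OF assms(1), of w' "max k d"]) auto
  then have "u = w d" by (simp add: w'_def)
  then show ?thesis using w(1) by simp
qed


section \<open>Linear automorphisms and matrix units\<close>

lemma linear_AutI:
  assumes "\<And>x. f x \<in> free_lie.span (range gen)"
    and "\<And>x. extend_gens f' (f x) = gen x" "\<And>x. extend_gens f (f' x) = gen x"
  shows "extend_gens f \<in> carrier linear_Aut_F"
proof -
  have "extend_gens f' \<circ> extend_gens f = id" "extend_gens f \<circ> extend_gens f' = id"
    by (rule lie_endo_eqI[OF lie_endo_comp[OF lie_endo_extend_gens lie_endo_extend_gens] lie_endo_id];
        simp add: assms)+
  then show ?thesis
    using assms(1) lie_endo_extend_gens by (auto simp: carrier_linear_Aut_F carrier_Aut_F)
qed

lemma span_gen [simp]: "gen x \<in> free_lie.span (range gen)"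
  by (simp add: free_lie.span_base)

lemma scaling_linear_Aut: "c \<noteq> 0 \<Longrightarrow> scaling c \<in> carrier linear_Aut_F"
  by (rule linear_AutI[of _ "\<lambda>x. fl_scale (1 / c) (gen x)"]) (simp_all add: free_lie.span_scale)

text \<open>The endomorphism that multiplies one generator by a scalar and fixes the others.\<close>

definition dilation :: "'x \<Rightarrow> 'p::field \<Rightarrow> ('p, 'x) free_lie \<Rightarrow> ('p, 'x) free_lie" where
  "dilation i a = extend_gens (\<lambda>x. if x = i then fl_scale a (gen x) else gen x)"

text \<open>The endomorphism that adds the generator \<open>i\<close> to the generator \<open>j\<close> and fixes the others.\<close>

definition transvection :: "'x \<Rightarrow> 'x \<Rightarrow> ('p::field, 'x) free_lie \<Rightarrow> ('p, 'x) free_lie" where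
  "transvection j i = extend_gens (\<lambda>x. if x = j then gen j + gen i else gen x)"

text \<open>The endomorphism that sends one generator to a given element and kills the others. If
  the given element is a generator, this is a matrix unit.\<close>

definition column :: "'x \<Rightarrow> ('p::field, 'x) free_lie \<Rightarrow> ('p, 'x) free_lie \<Rightarrow> ('p, 'x) free_lie" where
  "column j u = extend_gens (\<lambda>x. if x = j then u else 0)"

lemma dilation_gen [simp]:
  "dilation i a (gen x) = (if x = i then fl_scale a (gen x) else gen x)"
  by (simp add: dilation_def)

lemma transvection_gen [simp]:
  "transvection j i (gen x) = (if x = j then gen j + gen i else gen x)"
  by (simp add: transvection_def)

lemma column_gen [simp]: "column j u (gen x) = (if x = j then u else 0)"
  by (simp add: column_def)

lemma lie_endo_elementary [simp]:
  "lie_endo (dilation i a)" "lie_endo (transvection j i)" "lie_endo (column j u)"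
  by (simp_all add: dilation_def transvection_def column_def lie_endo_extend_gens)

lemma dilation_linear_Aut: "a \<noteq> 0 \<Longrightarrow> dilation i a \<in> carrier linear_Aut_F"
  unfolding dilation_def
  by (rule linear_AutI[of _ "\<lambda>x. if x = i then fl_scale (1 / a) (gen x) else gen x"])
    (simp_all add: free_lie.span_scale)

lemma transvection_linear_Aut:
  assumes "j \<noteq> i"
  shows "transvection j i \<in> carrier linear_Aut_F"
  unfolding transvection_def
  by (rule linear_AutI[of _ "\<lambda>x. if x = j then gen j + fl_scale (- 1) (gen i) else gen x"])
    (use assms in \<open>simp_all add: free_lie.span_add\<close>)

lemma comp_column: "lie_endo \<phi> \<Longrightarrow> \<phi> \<circ> column j u = column j (\<phi> u)"
  by (rule lie_endo_eqI) (simp_all add: lie_endo_comp lie_endo_zero)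

lemma column_span:
  assumes "v \<in> free_lie.span (range gen)"
  shows "column j u v = fl_scale (coord j v) u"
  using assms
proof (induction v rule: free_lie.span_induct_alt)
  case base
  then show ?case by (simp add: column_def)
next
  case (step c v w)
  then show ?case
    by (auto simp: lie_endoD[OF lie_endo_elementary(3)] free_lie.scale_left_distrib)
qed

lemma column_zero: "column j 0 = (\<lambda>_. 0)"
proof (rule lie_endo_eqI)
  show "lie_endo (\<lambda>_. 0 :: ('a, 'b) free_lie)" by (rule lie_endoI) simp_all
qed simp_all

lemma transvection_span:
  assumes "v \<in> free_lie.span (range gen)"
  shows "transvection j i v = v + fl_scale (coord j v) (gen i)"
  using assms
proof (induction v rule: free_lie.span_induct_alt)
  case base
  then show ?case by (simp add: transvection_def)
next
  case (step c v w)
  then show ?case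
    by (auto simp: lie_endoD[OF lie_endo_elementary(2)] free_lie.scale_left_distrib
        free_lie.scale_right_distrib)
qed


section \<open>Automorphisms that are diagonal on the linear automorphisms\<close>

text \<open>The data of a quasi-stable automorphism in unfolded form. The factor \<open>h\<close> is only required
  to be nonzero; its multiplicativity plays no role. Surjectivity onto the linear automorphisms is a
  separate condition, since bijectivity on all endomorphisms does not provide linear preimages.\<close>

locale diagonal_on_linear =
  fixes \<xi> :: "(('p::field, 'x::finite) free_lie \<Rightarrow> ('p, 'x) free_lie) \<Rightarrow>
              (('p, 'x) free_lie \<Rightarrow> ('p, 'x) free_lie)"
    and h :: "(('p, 'x) free_lie \<Rightarrow> ('p, 'x) free_lie) \<Rightarrow> 'p"
  assumes infinite_field: "infinite (UNIV :: 'p set)"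
    and card_gens: "CARD('x) \<ge> 2"
    and xi_bij: "bij_betw \<xi> {\<phi>. lie_endo \<phi>} {\<phi>. lie_endo \<phi>}"
    and xi_comp: "lie_endo \<phi> \<Longrightarrow> lie_endo \<psi> \<Longrightarrow> \<xi> (\<phi> \<circ> \<psi>) = \<xi> \<phi> \<circ> \<xi> \<psi>"
    and xi_onto_linear: "g \<in> carrier linear_Aut_F \<Longrightarrow> \<exists>g' \<in> carrier linear_Aut_F. \<xi> g' = g"
    and h_nonzero: "g \<in> carrier linear_Aut_F \<Longrightarrow> h g \<noteq> 0"
    and xi_linear: "g \<in> carrier linear_Aut_F \<Longrightarrow> \<xi> g (gen x) = fl_scale (h g) (g (gen x))"
begin

lemma linear_endo: "g \<in> carrier linear_Aut_F \<Longrightarrow> lie_endo (g :: ('p, 'x) free_lie \<Rightarrow> _)"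
  by (simp add: carrier_linear_Aut_F carrier_Aut_F)

lemma xi_endo: "lie_endo \<phi> \<Longrightarrow> lie_endo (\<xi> \<phi>)"
  using xi_bij by (auto simp: bij_betw_def)

lemma xi_inj: "lie_endo \<phi> \<Longrightarrow> lie_endo \<psi> \<Longrightarrow> \<xi> \<phi> = \<xi> \<psi> \<Longrightarrow> \<phi> = \<psi>"
  using xi_bij by (auto simp: bij_betw_def inj_on_def)

lemma xi_surj:
  assumes "lie_endo \<psi>"
  obtains \<phi> where "lie_endo \<phi>" "\<xi> \<phi> = \<psi>"
proof -
  have "\<psi> \<in> \<xi> ` {\<phi>. lie_endo \<phi>}" using xi_bij assms by (simp add: bij_betw_def)
  then show thesis by (rule imageE) (use that in simp)
qed

lemma exists_other_gen: "\<exists>j::'x. j \<noteq> i"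
proof (rule ccontr)
  assume "\<not> (\<exists>j. j \<noteq> i)"
  then have "UNIV = {i}" by auto
  then have "CARD('x) = 1" by (metis card.empty card.insert empty_iff finite.emptyI One_nat_def)
  then show False using card_gens by simp
qed

text \<open>The zero endomorphism is characterized by absorption.\<close>

lemma xi_zero: "\<xi> (column j 0) = column j 0"
proof -
  obtain \<phi> where \<phi>: "lie_endo \<phi>" "\<xi> \<phi> = column j 0"
    using xi_surj lie_endo_elementary(3) by metis
  have "column j 0 \<circ> \<phi> = column j 0" by (simp add: column_zero comp_def)
  then have "\<xi> (column j 0) = \<xi> (column j 0) \<circ> column j 0"
    using xi_comp[of "column j 0" \<phi>] \<phi> by simp
  also have "\<dots> = column j (\<xi> (column j 0) 0)"
    by (simp add: comp_column xi_endo)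
  also have "\<xi> (column j 0) 0 = 0" by (simp add: lie_endo_zero xi_endo)
  finally show ?thesis .
qed

text \<open>The linear endomorphisms are those that commute with the scalings, and the scalings are
  permuted by \<open>\<xi>\<close>.\<close>

lemma xi_preserves_linear:
  assumes "lie_endo \<phi>" "\<And>x. \<phi> (gen x) \<in> free_lie.span (range gen)"
  shows "\<xi> \<phi> (gen x) \<in> free_lie.span (range gen)"
proof -
  have "scaling c (\<xi> \<phi> (gen x)) = fl_scale (c ^ 1) (\<xi> \<phi> (gen x))" if c: "c \<noteq> 0" for c
  proof -
    obtain g where g: "g \<in> carrier linear_Aut_F" "\<xi> g = scaling c"
      using xi_onto_linear scaling_linear_Aut[OF c] by metis
    have "g (gen y) = fl_scale (c / h g) (gen y)" for y
    proof -
      have "fl_scale (1 / h g) (fl_scale (h g) (g (gen y))) = fl_scale (1 / h g) (fl_scale c (gen y))"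
        using xi_linear[OF g(1), of y] g(2) by simp
      then show ?thesis using h_nonzero[OF g(1)] by simp
    qed
    then have g': "g = scaling (c / h g)"
      by (rule extend_gens_eqI[OF linear_endo[OF g(1)]])
    have "\<phi> \<circ> scaling (c / h g) = scaling (c / h g) \<circ> \<phi>"
      by (rule lie_endo_eqI)
        (simp_all add: lie_endo_comp lie_endo_extend_gens assms scaling_span lie_endo_scale)
    then have "\<xi> \<phi> \<circ> scaling c = scaling c \<circ> \<xi> \<phi>"
      using xi_comp[OF assms(1) linear_endo[OF g(1)]] xi_comp[OF linear_endo[OF g(1)] assms(1)] g' g(2)
      by metis
    then have "scaling c (\<xi> \<phi> (gen x)) = \<xi> \<phi> (scaling c (gen x))" by (metis comp_apply)
    then show ?thesis by (simp add: lie_endo_scale xi_endo assms)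
  qed
  then have "homogeneous 1 (\<xi> \<phi> (gen x))" by (rule homogeneousI_scaling[OF infinite_field])
  then show ?thesis using homogeneous_low_degree by blast
qed

lemma xi_projection_span: "\<xi> (column i (gen i)) (gen x) \<in> free_lie.span (range gen)"
  by (rule xi_preserves_linear) (simp_all add: free_lie.span_zero)

lemma xi_projection_image_fixed:
  assumes g: "g \<in> carrier linear_Aut_F" "g (gen i) = gen i"
  shows "fl_scale (h g) (g (\<xi> (column i (gen i)) (gen x))) = \<xi> (column i (gen i)) (gen x)"
proof -
  have "g \<circ> column i (gen i) = column i (gen i)"
    using g by (simp add: comp_column linear_endo)
  then have "\<xi> g \<circ> \<xi> (column i (gen i)) = \<xi> (column i (gen i))"
    using xi_comp[of g "column i (gen i)"] linear_endo[OF g(1)] by simp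
  then have "\<xi> g (\<xi> (column i (gen i)) (gen x)) = \<xi> (column i (gen i)) (gen x)"
    by (metis comp_apply)
  moreover have "\<xi> g (\<xi> (column i (gen i)) (gen x))
      = fl_scale (h g) (g (\<xi> (column i (gen i)) (gen x)))"
    by (rule lie_endo_scales_span[OF xi_endo[OF linear_endo[OF g(1)]] xi_linear[OF g(1)]
          linear_endo[OF g(1)] xi_projection_span])
  ultimately show ?thesis by simp
qed

text \<open>A multiple of a transvection has all its fixed vectors in a coordinate hyperplane.
  The transvections that fix a generator thus confine the image of its coordinate projection
  under \<open>\<xi>\<close> to the line of this generator.\<close>

lemma xi_projection_line:
  "\<exists>a. \<xi> (column i (gen i)) (gen x) = fl_scale a (gen i)"
proof -
  define v where "v = \<xi> (column i (gen i)) (gen x)"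
  have v: "v \<in> free_lie.span (range gen)" unfolding v_def by (rule xi_projection_span)
  have zero: "coord j v = 0" if "j \<noteq> i" for j
  proof (rule ccontr)
    assume nz: "coord j v \<noteq> 0"
    let ?t = "transvection j i :: ('p, 'x) free_lie \<Rightarrow> _"
    have "fl_scale (h ?t) (?t v) = v"
      unfolding v_def using transvection_linear_Aut[OF that] that
      by (intro xi_projection_image_fixed) auto
    then have eq: "fl_scale (h ?t) (v + fl_scale (coord j v) (gen i)) = v"
      by (simp add: transvection_span[OF v])
    from arg_cong[OF eq, of "coord j"] that nz have "h ?t = 1" by simp
    with arg_cong[OF eq, of "coord i"] nz show False by simp
  qed
  have "v = (\<Sum>y\<in>UNIV. fl_scale (coord y v) (gen y))" by (rule span_gen_expand[OF v])
  also have "\<dots> = (\<Sum>y\<in>UNIV. if y = i then fl_scale (coord i v) (gen i) else 0)"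
    by (rule sum.cong) (auto simp: zero)
  also have "\<dots> = fl_scale (coord i v) (gen i)" by simp
  finally show ?thesis unfolding v_def by blast
qed

lemma xi_projection_nonzero: "\<exists>x. \<xi> (column i (gen i)) (gen x) \<noteq> 0"
proof (rule ccontr)
  assume "\<not> ?thesis"
  then have "\<xi> (column i (gen i)) = \<xi> (column i 0)"
    unfolding xi_zero by (intro lie_endo_eqI xi_endo) simp_all
  then have "column i (gen i) (gen i) = column i 0 (gen i :: ('p, 'x) free_lie)"
    using xi_inj lie_endo_elementary(3) by metis
  then show False by simp
qed

lemma h_eq_1_if_fixes_gen:
  assumes g: "g \<in> carrier linear_Aut_F" "g (gen i) = gen i"
  shows "h g = 1"
proof -
  obtain x where x: "\<xi> (column i (gen i)) (gen x) \<noteq> 0" using xi_projection_nonzero by blast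
  obtain a where a: "\<xi> (column i (gen i)) (gen x) = fl_scale a (gen i)"
    using xi_projection_line by blast
  have "fl_scale (h g) (fl_scale a (gen i)) = fl_scale a (gen i :: ('p, 'x) free_lie)"
    using xi_projection_image_fixed[OF g, of x] g
    by (simp add: a lie_endo_scale linear_endo)
  then have "h g * a = a" using arg_cong[where f = "coord i"] by fastforce
  then show ?thesis using x a by auto
qed

lemma xi_fixes_if_h_eq_1:
  assumes "g \<in> carrier linear_Aut_F" "h g = 1"
  shows "\<xi> g = g"
  by (rule lie_endo_eqI) (use assms in \<open>simp_all add: xi_endo linear_endo xi_linear\<close>)

lemma xi_projection: "\<xi> (column i (gen i)) = column i (gen i)"
proof -
  let ?e = "column i (gen i) :: ('p, 'x) free_lie \<Rightarrow> _"
  have off: "\<xi> ?e (gen j) = 0" if "j \<noteq> i" for j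
  proof -
    have "infinite (UNIV - {0, 1 :: 'p})" using infinite_field by simp
    then obtain b :: 'p where "b \<in> UNIV - {0, 1}" by (metis ex_in_conv finite.emptyI)
    then have b: "b \<noteq> 0" "b \<noteq> 1" by auto
    have d: "dilation j b \<in> carrier linear_Aut_F" using b by (simp add: dilation_linear_Aut)
    have "\<xi> (dilation j b) = dilation j b"
      using h_eq_1_if_fixes_gen[OF d, of i] that by (intro xi_fixes_if_h_eq_1 d) simp
    moreover have "?e \<circ> dilation j b = ?e"
      by (rule lie_endo_eqI) (use that in \<open>auto simp: lie_endo_comp lie_endo_scale\<close>)
    ultimately have "\<xi> ?e \<circ> dilation j b = \<xi> ?e"
      using xi_comp[of ?e "dilation j b"] by simp
    then have "\<xi> ?e (dilation j b (gen j)) = \<xi> ?e (gen j)" by (metis comp_apply)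
    then have "fl_scale b (\<xi> ?e (gen j)) = \<xi> ?e (gen j)"
      by (simp add: lie_endo_scale xi_endo)
    then have "fl_scale (b - 1) (\<xi> ?e (gen j)) = 0"
      by (simp add: free_lie.scale_left_diff_distrib)
    then show ?thesis using b by simp
  qed
  obtain a where a: "\<xi> ?e (gen i) = fl_scale a (gen i)" using xi_projection_line by blast
  have "a \<noteq> 0" using xi_projection_nonzero[of i] off a by (metis free_lie.scale_zero_left)
  have "?e \<circ> ?e = ?e" by (simp add: comp_column)
  then have "\<xi> ?e (\<xi> ?e (gen i)) = \<xi> ?e (gen i)"
    using xi_comp[of ?e ?e] by (metis comp_apply lie_endo_elementary(3))
  then have "fl_scale (a * a) (gen i) = fl_scale a (gen i :: ('p, 'x) free_lie)"
    by (simp add: a lie_endo_scale xi_endo)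
  then have "a * a = a" using arg_cong[where f = "coord i"] by fastforce
  then have "a = 1" using \<open>a \<noteq> 0\<close> by simp
  show ?thesis
    by (rule lie_endo_eqI) (use off a \<open>a = 1\<close> in \<open>simp_all add: xi_endo\<close>)
qed

lemma xi_matrix_unit: "\<xi> (column j (gen i)) = column j (gen i)"
proof (cases "i = j")
  case True
  then show ?thesis using xi_projection by simp
next
  case False
  let ?t = "transvection j i :: ('p, 'x) free_lie \<Rightarrow> _"
  have t: "?t \<in> carrier linear_Aut_F" using False by (simp add: transvection_linear_Aut)
  have "\<xi> ?t = ?t"
    using h_eq_1_if_fixes_gen[OF t, of i] False by (intro xi_fixes_if_h_eq_1 t) simp
  moreover have "column j (gen i) = column i (gen i) \<circ> (?t \<circ> column j (gen j))"
    using False by (simp add: comp_column lie_endo_add)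
  ultimately show ?thesis
    by (simp add: xi_comp lie_endo_comp xi_projection)
qed

text \<open>An invertible matrix has a nonzero entry. Multiplying by matrix units on both sides
  isolates this entry, and the result is a product of endomorphisms that \<open>\<xi>\<close> is
  already known to fix.\<close>

lemma xi_fixes_linear:
  assumes g: "g \<in> carrier linear_Aut_F"
  shows "\<xi> g = g"
proof -
  fix j :: 'x
  have e: "lie_endo g" by (rule linear_endo[OF g])
  have gj: "g (gen j) \<in> free_lie.span (range gen)" using g by (simp add: carrier_linear_Aut_F)
  obtain k where "lie_endo k" "k \<circ> g = id"
    using g by (auto simp: carrier_linear_Aut_F carrier_Aut_F)
  then have "g (gen j) \<noteq> 0"
    by (metis comp_apply gen_nonzero id_apply lie_endo_zero)
  then obtain i where "coord i (g (gen j)) \<noteq> 0"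
    using span_gen_expand[OF gj] by (metis (no_types, lifting) free_lie.scale_zero_left sum.neutral)
  moreover define a where "a = coord i (g (gen j))"
  ultimately have "a \<noteq> 0" by simp
  then have d: "dilation i a \<in> carrier linear_Aut_F" by (rule dilation_linear_Aut)
  obtain l where "l \<noteq> i" using exists_other_gen by blast
  then have "\<xi> (dilation i a) = dilation i a"
    using h_eq_1_if_fixes_gen[OF d, of l] by (intro xi_fixes_if_h_eq_1 d) simp
  then have "\<xi> (column i (gen i) \<circ> (g \<circ> column j (gen j))) = dilation i a \<circ> column j (gen i)"
    using xi_comp[of "dilation i a" "column j (gen i)"] e gj
    by (simp add: comp_column column_span xi_matrix_unit a_def)
  then have "column i (gen i) \<circ> (\<xi> g \<circ> column j (gen j)) = dilation i a \<circ> column j (gen i)"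
    by (simp add: xi_comp lie_endo_comp e xi_projection)
  from fun_cong[OF this, of "gen j"]
  have "column i (gen i) (\<xi> g (gen j)) = fl_scale a (gen i)" by simp
  moreover have "column i (gen i) (\<xi> g (gen j)) = fl_scale (h g * a) (gen i)"
    by (simp add: xi_linear[OF g] lie_endo_scale column_span[OF gj] a_def)
  ultimately have "h g * a = a" using arg_cong[where f = "coord i"] by fastforce
  then have "h g = 1" using \<open>a \<noteq> 0\<close> by simp
  then show ?thesis by (rule xi_fixes_if_h_eq_1[OF g])
qed


section \<open>The underlying permutation of the free Lie algebra\<close>

text \<open>Elements of the algebra correspond to endomorphisms concentrated on one generator, by
  \<^const>\<open>column\<close>. As \<open>\<xi>\<close> preserves this class of endomorphisms, it permutes the elements.
  The choice of the generator is immaterial.\<close>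

definition base_gen :: 'x where "base_gen = (SOME x. True)"

definition perm :: "('p, 'x) free_lie \<Rightarrow> ('p, 'x) free_lie" where
  "perm u = \<xi> (column base_gen u) (gen base_gen)"

lemma xi_column: "\<xi> (column base_gen u) = column base_gen (perm u)"
proof -
  have "column base_gen u \<circ> column base_gen (gen base_gen) = column base_gen u"
    by (simp add: comp_column)
  then have "\<xi> (column base_gen u) = \<xi> (column base_gen u) \<circ> column base_gen (gen base_gen)"
    using xi_comp[of "column base_gen u" "column base_gen (gen base_gen)"]
    by (simp add: xi_projection)
  also have "\<dots> = column base_gen (perm u)" by (simp add: comp_column xi_endo perm_def)
  finally show ?thesis .
qed

lemma column_inject: "column j u = column j v \<longleftrightarrow> u = v"
  by (metis column_gen)

lemma xi_perm: "lie_endo \<phi> \<Longrightarrow> \<xi> \<phi> (perm u) = perm (\<phi> u)"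
  using xi_comp[of \<phi> "column base_gen u"] comp_column[of \<phi> base_gen u]
    comp_column[of "\<xi> \<phi>" base_gen "perm u"]
  by (simp add: xi_column xi_endo column_inject)

lemma perm_gen [simp]: "perm (gen x) = gen x"
  by (simp add: perm_def xi_matrix_unit)

lemma xi_gen: "lie_endo \<phi> \<Longrightarrow> \<xi> \<phi> (gen x) = perm (\<phi> (gen x))"
  using xi_perm[of \<phi> "gen x"] by simp

lemma perm_zero [simp]: "perm 0 = 0"
  by (simp add: perm_def xi_zero)

lemma perm_bij: "bij perm"
proof (rule bijI)
  show "inj perm"
    by (rule injI) (metis xi_column xi_inj lie_endo_elementary(3) column_inject)
  show "surj perm"
  proof (rule surjI)
    fix w
    obtain \<phi> where \<phi>: "lie_endo \<phi>" "\<xi> \<phi> = column base_gen w"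
      using xi_surj lie_endo_elementary(3) by metis
    have "perm (\<phi> (gen base_gen)) = w"
      using xi_gen[OF \<phi>(1), of base_gen] \<phi>(2) by simp
    then show "perm (SOME u. perm u = w) = w" by (rule someI)
  qed
qed

lemma perm_scale: "perm (fl_scale a u) = fl_scale a (perm u)"
proof (cases "a = 0")
  case False
  have "column base_gen (fl_scale a u) = column base_gen u \<circ> scaling a"
    by (rule lie_endo_eqI) (simp_all add: lie_endo_comp lie_endo_extend_gens lie_endo_scale)
  then have "\<xi> (column base_gen (fl_scale a u)) = \<xi> (column base_gen u) \<circ> scaling a"
    using xi_comp[of "column base_gen u" "scaling a"] xi_fixes_linear[OF scaling_linear_Aut[OF False]]
    by (simp add: lie_endo_extend_gens)
  then show ?thesis
    by (simp add: perm_def lie_endo_scale xi_endo)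
qed simp

text \<open>The endomorphism that sends two generators to given elements and kills the others. It makes
  sums and brackets of arbitrary elements images of sums and brackets of generators.\<close>

definition pair_map :: "'x \<Rightarrow> 'x \<Rightarrow> ('p, 'x) free_lie \<Rightarrow> ('p, 'x) free_lie \<Rightarrow>
    ('p, 'x) free_lie \<Rightarrow> ('p, 'x) free_lie" where
  "pair_map i j u v = extend_gens (\<lambda>x. if x = i then u else if x = j then v else 0)"

lemma pair_map_gen [simp]:
  "pair_map i j u v (gen x) = (if x = i then u else if x = j then v else 0)"
  by (simp add: pair_map_def)

lemma lie_endo_pair_map [simp]: "lie_endo (pair_map i j u v)"
  by (simp add: pair_map_def lie_endo_extend_gens)

lemma xi_pair_map: "\<xi> (pair_map i j u v) = pair_map i j (perm u) (perm v)"
  by (rule lie_endo_eqI) (simp_all add: xi_endo xi_gen)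

lemma perm_add: "perm (u + v) = perm u + perm v"
proof -
  obtain i j :: 'x where ij: "j \<noteq> i" using exists_other_gen by blast
  let ?t = "transvection j i :: ('p, 'x) free_lie \<Rightarrow> _"
  have "perm (gen j + gen i) = perm (?t (gen j))" by simp
  also have "\<dots> = \<xi> ?t (gen j)" using xi_gen[of ?t j] by simp
  also have "\<dots> = gen j + gen i"
    using xi_fixes_linear[OF transvection_linear_Aut[OF ij]] by simp
  finally have *: "perm (gen j + gen i) = gen j + gen i" .
  have "perm (u + v) = perm (pair_map j i u v (gen j + gen i))"
    using ij by (simp add: lie_endo_add)
  also have "\<dots> = pair_map j i (perm u) (perm v) (perm (gen j + gen i))"
    by (simp add: xi_perm[symmetric] xi_pair_map)
  also have "\<dots> = perm u + perm v" using ij by (simp add: * lie_endo_add)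
  finally show ?thesis .
qed

lemma perm_bracket:
  "\<exists>c. c \<noteq> 0 \<and> (\<forall>u v. perm (fl_bracket u v) = fl_scale c (fl_bracket (perm u) (perm v)))"
proof -
  obtain i j :: 'x where ij: "j \<noteq> i" using exists_other_gen by blast
  let ?b = "fl_bracket (gen i) (gen j) :: ('p, 'x) free_lie"
  define z where "z = perm ?b"
  have "scaling a z = fl_scale (a ^ 2) z" if a: "a \<noteq> 0" for a
  proof -
    have "scaling a z = \<xi> (scaling a) (perm ?b)"
      using xi_fixes_linear[OF scaling_linear_Aut[OF a]] by (simp add: z_def)
    also have "\<dots> = perm (scaling a ?b)" by (rule xi_perm[OF lie_endo_extend_gens])
    also have "\<dots> = fl_scale (a ^ 2) z"
      by (simp add: free_lie.bracket_scale_left free_lie.bracket_scale_right perm_scale z_def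
          power2_eq_square)
    finally show ?thesis .
  qed
  then have "homogeneous 2 z" by (rule homogeneousI_scaling[OF infinite_field])
  then have "z \<in> free_lie.span {fl_bracket (gen x) (gen y) | x y. True}"
    using homogeneous_low_degree by blast
  \<comment> \<open>Killing the generators other than \<open>i\<close> and \<open>j\<close> leaves a multiple of the bracket of these two;
    on the other hand it fixes \<open>z\<close>, as it fixes this bracket.\<close>
  then have "\<exists>c. pair_map i j (gen i) (gen j) z = fl_scale c ?b"
  proof (induction z rule: free_lie.span_induct_alt)
    case base
    show ?case by (rule exI[of _ 0]) (simp add: lie_endo_zero)
  next
    case (step a w z)
    then obtain c where c: "pair_map i j (gen i) (gen j) z = fl_scale c ?b" by blast
    have anti: "fl_bracket (gen j) (gen i) = fl_scale (- 1) ?b"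
    proof -
      have "fl_bracket (gen i + gen j) (gen i + gen j) = (0 :: ('p, 'x) free_lie)"
        by (rule free_lie.bracket_self)
      then have "fl_bracket (gen j) (gen i) + ?b = 0"
        unfolding free_lie.bracket_add_left free_lie.bracket_add_right
        by (simp add: free_lie.bracket_self)
      then show ?thesis by (simp add: eq_neg_iff_add_eq_0)
    qed
    have "\<exists>d. pair_map i j (gen i) (gen j) w = fl_scale d ?b"
    proof -
      obtain x y where w: "w = fl_bracket (gen x) (gen y)" using step by blast
      consider "x = i" "y = j" | "x = j" "y = i" | "x = y" | "x \<notin> {i, j} \<or> y \<notin> {i, j}" by blast
      then show ?thesis
      proof cases
        case 1
        then show ?thesis using ij by (intro exI[of _ 1]) (simp add: w lie_endo_bracket)
      next
        case 2
        then show ?thesis using ij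
          by (intro exI[of _ "- 1"]) (simp add: w lie_endo_bracket lie_endo_minus anti)
      qed (intro exI[of _ 0], auto simp: w lie_endo_bracket lie_endo_zero free_lie.bracket_self)+
    qed
    then obtain d where d: "pair_map i j (gen i) (gen j) w = fl_scale d ?b" by blast
    show ?case
      by (rule exI[of _ "a * d + c"])
        (simp add: lie_endo_add lie_endo_scale c d free_lie.scale_left_distrib)
  qed
  then obtain c where c: "pair_map i j (gen i) (gen j) z = fl_scale c ?b" by blast
  have "pair_map i j (gen i) (gen j) z = \<xi> (pair_map i j (gen i) (gen j)) (perm ?b)"
    by (simp add: xi_pair_map z_def)
  also have "\<dots> = perm (pair_map i j (gen i) (gen j) ?b)" by (rule xi_perm) simp
  also have "\<dots> = z" using ij by (simp add: lie_endo_bracket z_def)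
  finally have z: "z = fl_scale c ?b" using c by simp
  \<comment> \<open>If the coefficient vanishes, the bracket of the two generators is zero and any
    coefficient will do; so it need not be shown that this bracket is nonzero.\<close>
  have "\<exists>c. c \<noteq> 0 \<and> z = fl_scale c ?b"
  proof (cases "c = 0")
    case True
    then have "perm ?b = perm 0" using z by (simp add: z_def)
    then have "?b = 0" using perm_bij by (metis bij_is_inj injD)
    then show ?thesis using z by (intro exI[of _ 1]) simp
  next
    case False
    then show ?thesis using z by blast
  qed
  then obtain c where c: "c \<noteq> 0" "z = fl_scale c ?b" by blast
  have "perm (fl_bracket u v) = fl_scale c (fl_bracket (perm u) (perm v))" for u v
  proof -
    have "perm (fl_bracket u v) = perm (pair_map i j u v ?b)"
      using ij by (simp add: lie_endo_bracket)
    also have "\<dots> = pair_map i j (perm u) (perm v) z"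
      by (simp add: xi_perm[symmetric] xi_pair_map z_def)
    also have "\<dots> = fl_scale c (fl_bracket (perm u) (perm v))"
      using ij by (simp add: c(2) lie_endo_scale lie_endo_bracket)
    finally show ?thesis .
  qed
  then show ?thesis using c(1) by blast
qed

lemma xi_inner: "inner_automorphism \<xi>"
proof -
  obtain c where c: "c \<noteq> 0"
    "\<And>u v. perm (fl_bracket u v) = fl_scale c (fl_bracket (perm u) (perm v))"
    using perm_bracket by blast
  \<comment> \<open>The factor turns the rule for brackets into multiplicativity.\<close>
  define f where "f u = fl_scale c (perm u)" for u
  have f: "lie_endo f"
    by (rule lie_endoI)
      (simp_all add: f_def perm_add perm_scale c(2) free_lie.scale_right_distrib mult.commute
        free_lie.bracket_scale_left free_lie.bracket_scale_right)
  have "bij f"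
  proof (rule bijI)
    show "inj f"
      using c(1) perm_bij by (auto simp: f_def inj_def dest: bij_is_inj)
    show "surj f"
    proof (rule surjI)
      fix w
      show "f (inv_into UNIV perm (fl_scale (1 / c) w)) = w"
        using c(1) perm_bij by (simp add: f_def bij_is_surj surj_f_inv_f)
    qed
  qed
  define k where "k = inv_into UNIV f"
  have k [simp]: "k (f u) = u" "f (k u) = u" for u
    using \<open>bij f\<close> by (simp_all add: k_def bij_is_inj bij_is_surj surj_f_inv_f)
  have k_endo: "lie_endo k"
  proof (rule lie_endoI)
    fix u v a
    show "k (u + v) = k u + k v"
      by (metis k lie_endo_add[OF f])
    show "k (fl_scale a u) = fl_scale a (k u)"
      by (metis k lie_endo_scale[OF f])
    show "k (fl_bracket u v) = fl_bracket (k u) (k v)"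
      by (metis k lie_endo_bracket[OF f])
  qed
  have Aut: "f \<in> carrier Aut_F"
    using f k_endo by (auto simp: carrier_Aut_F fun_eq_iff)
  interpret E: monoid "End_F :: (('p, 'x) free_lie \<Rightarrow> ('p, 'x) free_lie) monoid"
    by (rule monoid_End_F)
  have "f \<in> Units End_F" using Aut by (simp add: units_of_def)
  from E.Units_r_inv[OF this] have r: "f \<circ> inv\<^bsub>End_F\<^esub> f = id" by simp
  have "\<xi> \<phi> = f \<circ> \<phi> \<circ> inv\<^bsub>End_F\<^esub> f" if \<phi>: "lie_endo \<phi>" for \<phi>
  proof -
    have "\<xi> \<phi> \<circ> f = f \<circ> \<phi>"
      by (rule ext) (simp add: f_def lie_endo_scale xi_endo xi_perm \<phi>)
    then have "\<xi> \<phi> \<circ> f \<circ> inv\<^bsub>End_F\<^esub> f = f \<circ> \<phi> \<circ> inv\<^bsub>End_F\<^esub> f" by simp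
    then show ?thesis by (simp add: comp_assoc r)
  qed
  with Aut show ?thesis
    by (auto simp: inner_automorphism_def carrier_End_F)
qed

end


section \<open>Quasi-stable automorphisms\<close>

theorem proposition3:
  fixes \<xi> :: "(('p::field, 'x::finite) free_lie \<Rightarrow> ('p, 'x) free_lie) \<Rightarrow>
               (('p, 'x) free_lie \<Rightarrow> ('p, 'x) free_lie)"
  assumes "infinite (UNIV :: 'p set)"
    and "CARD('x) \<ge> 2"
    and "quasi_stable \<xi>"
  shows "linearly_stable \<xi> \<and> inner_automorphism \<xi>"
proof -
  let ?L = "carrier (linear_Aut_F :: (('p, 'x) free_lie \<Rightarrow> ('p, 'x) free_lie) monoid)"
  have iso: "\<xi> \<in> iso End_F End_F" and diag: "diagonal_automorphism (restrict \<xi> ?L)"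
    using assms(3) by (auto simp: quasi_stable_def)
  obtain h where h: "h \<in> hom linear_Aut_F mult_group_of_field"
    "\<And>g x. g \<in> ?L \<Longrightarrow> \<xi> g (gen x) = fl_scale (h g) (g (gen x))"
    using diag by (auto simp: diagonal_automorphism_def)
  have bij: "bij_betw (restrict \<xi> ?L) ?L ?L"
    using diag by (simp add: diagonal_automorphism_def iso_def)
  interpret diagonal_on_linear \<xi> h
  proof
    show "bij_betw \<xi> {\<phi>. lie_endo \<phi>} {\<phi>. lie_endo \<phi>}"
      using iso by (simp add: iso_def carrier_End_F)
    show "\<xi> (\<phi> \<circ> \<psi>) = \<xi> \<phi> \<circ> \<xi> \<psi>" if "lie_endo \<phi>" "lie_endo \<psi>" for \<phi> \<psi>
      using iso that by (auto simp: iso_def hom_def carrier_End_F)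
    show "\<exists>g' \<in> ?L. \<xi> g' = g" if "g \<in> ?L" for g
    proof -
      have "\<xi> ` ?L = ?L" using bij by (simp add: bij_betw_def)
      with that have "g \<in> \<xi> ` ?L" by simp
      then show ?thesis by blast
    qed
    show "h g \<noteq> 0" if "g \<in> ?L" for g
      using h(1) that by (auto simp: hom_def mult_group_of_field_def)
  qed (use assms h(2) in auto)
  show ?thesis
    using iso xi_fixes_linear xi_inner by (simp add: linearly_stable_def)
qed

end
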